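(* Let $k,n$ be integers with $k\geq 2$ and $n\geq 1$. If $A$ is a set of positive integers such that $\prod_{a\in B}a+n$ is a perfect $k$-th power for each finite subset $B$ of $A$, then $|A|\leq 132$ if $k=2$, and $|A|\leq 9$ if $k\geq 3$.
   Context: A perfect $k$-th power is the $k$-th power of an integer. The subset $B$ may be empty, and the product over the empty set is defined to be $1$. *)

theory Defs
  imports Complex_Main "HOL-Computational_Algebra.Nth_Powers"
begin

end

theory Submission
  imports Defs
begin

text \<open>
  Discard the element $1$, let $a < b$ be the two smallest elements that remain, and let $c$ be the
  product of all the others. Since $c + n$, $abc + n$, $ac + n$, $bc + n$ are $k$-th powers, so are
  \[ z^k = (c+n)(abc+n) \quad\mbox{and}\quad w^k = (ac+n)(bc+n), \]
  and both have leading term $abc^2$; their difference is only $nc(a-1)(b-1) > 0$. As $c$ is a product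
  of many elements, it is enormous compared with $a$ and $b$, and this is impossible.

  For $k \ge 3$ distinct $k$-th powers of this size are too far apart: the difference is at least
  $w^{k-1}$, which leads to $c^{k-2} < n^k ab$ (\<open>cofactor_bound\<close>).

  For $k = 2$ the gap between squares has the same order in $c$ as the difference, so the gap alone
  proves nothing. But $t = z - w$ tends to $n(a-1)(b-1)/(2\sqrt{ab})$ as $c$ grows, while $t$ is an
  integer. Runge's method turns this into an identity between integers which fails as soon as $c$ is
  larger than a polynomial in $n$, $a$, $b$ (\<open>cofactor_bound_squares\<close>).

  Finally $n$ is itself small compared with $a$: since $1+n$ and $a+n$ are distinct $k$-th powers,
  $n^{k-1} < a^k$ (\<open>shift_less_power\<close>). Hence $c$ is bounded by a power of $b$ whose exponent is smaller
  than the number of factors of $c$, all of which exceed $b$.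
\<close>

section \<open>Gaps between integer powers\<close>

lemma is_nth_power_int_pos:
  fixes x :: int
  assumes "is_nth_power k x" and "x > 0" and "k > 0"
  obtains y where "y > 0" and "y ^ k = x"
proof -
  obtain y where y: "x = y ^ k" using assms(1) by (auto simp: is_nth_power_def)
  have "\<bar>y\<bar> ^ k = x" using y assms(2) by (simp flip: power_abs)
  moreover have "y \<noteq> 0" using y assms(2,3) by (auto simp: power_0_left)
  ultimately show ?thesis using that[of "\<bar>y\<bar>"] by simp
qed

lemma power_gap:
  fixes w z :: int
  assumes "w \<ge> 0" and "w < z"
  shows "z ^ Suc m \<ge> w ^ Suc m + w ^ m"
proof -
  have "w ^ Suc m + w ^ m = (w + 1) * w ^ m" by (simp add: algebra_simps)
  also have "\<dots> \<le> z * z ^ m" using assms by (intro mult_mono power_mono) auto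
  finally show ?thesis by simp
qed

text \<open>The $k$-th power that follows $1 + n = x^k$ exceeds it by at least $x^{k-1} = (1+n)^{(k-1)/k}$, and
  $a - 1$ is no smaller than this gap.\<close>

lemma shift_less_power:
  fixes a n :: int
  assumes "is_nth_power (Suc m) (1 + n)" and "is_nth_power (Suc m) (a + n)" and "a > 1" and "n \<ge> 1"
  shows "n ^ m < a ^ Suc m"
proof -
  obtain x where x: "x > 0" "x ^ Suc m = 1 + n"
    using is_nth_power_int_pos[OF assms(1)] assms(4) by auto
  obtain y where y: "y > 0" "y ^ Suc m = a + n"
    using is_nth_power_int_pos[OF assms(2)] assms(3,4) by auto
  have "x ^ Suc m < y ^ Suc m" using x(2) y(2) assms(3) by simp
  hence "x < y" by (rule power_less_imp_less_base) (use y(1) in simp)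
  hence "x ^ m < a" using power_gap[of x y m] x y by simp
  hence "(x ^ m) ^ Suc m < a ^ Suc m" using x(1) by (intro power_strict_mono) auto
  also have "(x ^ m) ^ Suc m = (x ^ Suc m) ^ m" by (simp only: mult.commute flip: power_mult)
  finally have "(1 + n) ^ m < a ^ Suc m" using x(2) by simp
  moreover have "n ^ m \<le> (1 + n) ^ m" using assms(4) by (intro power_mono) auto
  ultimately show ?thesis by simp
qed

section \<open>Upper bounds for a cofactor\<close>

lemma close_nth_powers:
  fixes a b c n :: int
  assumes "k > 0" and "a > 1" and "b > 1" and "c > 0" and "n \<ge> 1"
    and "is_nth_power k (c + n)" and "is_nth_power k (a * c + n)"
    and "is_nth_power k (b * c + n)" and "is_nth_power k (a * b * c + n)"
  obtains w z where "0 < w" and "w < z"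
    and "w ^ k = (a * c + n) * (b * c + n)" and "z ^ k = (c + n) * (a * b * c + n)"
proof -
  have "is_nth_power k ((a * c + n) * (b * c + n))" "is_nth_power k ((c + n) * (a * b * c + n))"
    using assms(6-9) by (auto intro: is_nth_power_mult)
  moreover have "(a * c + n) * (b * c + n) > 0" "(c + n) * (a * b * c + n) > 0"
    using assms(2-5) by (auto intro!: mult_pos_pos add_pos_pos)
  ultimately obtain w z where w: "w > 0" "w ^ k = (a * c + n) * (b * c + n)"
    and z: "z > 0" "z ^ k = (c + n) * (a * b * c + n)"
    using assms(1) is_nth_power_int_pos by metis
  have "z ^ k - w ^ k = n * c * ((a - 1) * (b - 1))" using w(2) z(2) by (simp add: algebra_simps)
  also have "\<dots> > 0" using assms(2-5) by (intro mult_pos_pos) auto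
  finally have "w ^ k < z ^ k" by simp
  hence "w < z" by (rule power_less_imp_less_base) (use z(1) in simp)
  thus ?thesis using that w z by blast
qed

text \<open>The gap between $w^k$ and $z^k$ is at least $w^{k-1} \ge (abc^2)^{(k-1)/k}$. For $k = 2$ this
  is of order $c$, like the difference itself, and the conclusion is void of $c$.\<close>

lemma cofactor_bound:
  fixes a b c n :: int
  assumes "a > 1" and "b > 1" and "c > 0" and "n \<ge> 1"
    and "is_nth_power (m + 2) (c + n)" and "is_nth_power (m + 2) (a * c + n)"
    and "is_nth_power (m + 2) (b * c + n)" and "is_nth_power (m + 2) (a * b * c + n)"
  shows "c ^ m < n ^ (m + 2) * (a * b)"
proof -
  obtain w z where wz: "0 < w" "w < z" and w: "w ^ (m + 2) = (a * c + n) * (b * c + n)"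
    and z: "z ^ (m + 2) = (c + n) * (a * b * c + n)"
    using close_nth_powers[OF _ assms] by auto
  have pos: "a * b > 0" "n * c > 0" using assms by auto
  have "w ^ (m + 1) \<le> z ^ (m + 2) - w ^ (m + 2)" using power_gap[of w z "m + 1"] wz by simp
  also have "\<dots> = n * c * (a * b - (a + b - 1))" using w z by (simp add: algebra_simps)
  also have "\<dots> < n * c * (a * b)" using assms(1,2) pos by (intro mult_strict_left_mono) auto
  finally have "(w ^ (m + 1)) ^ (m + 2) < (n * c * (a * b)) ^ (m + 2)"
    using wz(1) by (intro power_strict_mono) auto
  also have "(w ^ (m + 1)) ^ (m + 2) = (w ^ (m + 2)) ^ (m + 1)"
    by (simp only: mult.commute flip: power_mult)
  finally have upper: "(w ^ (m + 2)) ^ (m + 1) < (n * c * (a * b)) ^ (m + 2)" .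
  have "a * c * (b * c) \<le> (a * c + n) * (b * c + n)"
    using assms(1-4) by (intro mult_mono) auto
  hence "(a * b * c\<^sup>2) ^ (m + 1) \<le> (w ^ (m + 2)) ^ (m + 1)"
    using assms(1-4) w by (intro power_mono) (auto simp: power2_eq_square mult_ac)
  also note upper
  finally have "((a * b) ^ (m + 1) * c ^ (m + 2)) * c ^ m
      < ((a * b) ^ (m + 1) * c ^ (m + 2)) * (n ^ (m + 2) * (a * b))"
    by (simp add: power_mult_distrib power_add power2_eq_square mult_ac)
  moreover have "(a * b) ^ (m + 1) * c ^ (m + 2) > 0" using pos assms(3) by auto
  ultimately show ?thesis by (simp only: mult_less_cancel_left_pos)
qed

text \<open>With $s = z + w$, $t = z - w$ and $M = n(a-1)(b-1)$ one has $st = Mc$, while $s^2 + t^2$ is a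
  quadratic polynomial in $c$. Eliminating $s$ leaves
  \[ c^2 (M^2 - 4abt^2) = t^2 (2n(a+1)(b+1)c + 4n^2 - t^2). \]
  Since $t \le M/2$ is bounded independently of $c$, the right-hand side is positive and of degree one
  in $c$ for large $c$. So the integer $M^2 - 4abt^2$ is at least $1$, and the left-hand side has
  degree two.\<close>

lemma cofactor_bound_squares:
  fixes a b c n :: int
  assumes "a > 1" and "b > 1" and "c > 0" and "n \<ge> 1"
    and "is_nth_power 2 (c + n)" and "is_nth_power 2 (a * c + n)"
    and "is_nth_power 2 (b * c + n)" and "is_nth_power 2 (a * b * c + n)"
  shows "c \<le> 3 * (n * a * b) ^ 3"
proof -
  obtain w z where wz: "0 < w" "w < z" and w: "w\<^sup>2 = (a * c + n) * (b * c + n)"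
    and z: "z\<^sup>2 = (c + n) * (a * b * c + n)"
    using close_nth_powers[OF _ assms] by auto
  define s t M L where "s = z + w" and "t = z - w" and "M = n * (a - 1) * (b - 1)"
    and "L = n * a * b"
  have t: "t > 0" using wz by (simp add: t_def)
  have ab: "a * b > 0" using assms by simp
  have "s * t = z\<^sup>2 - w\<^sup>2" by (simp add: s_def t_def power2_eq_square algebra_simps)
  also have "\<dots> = M * c" unfolding w z M_def by (simp add: algebra_simps)
  finally have st: "s * t = M * c" .
  have "s\<^sup>2 + t\<^sup>2 = 2 * (z\<^sup>2 + w\<^sup>2)" by (simp add: s_def t_def power2_eq_square algebra_simps)
  also have "\<dots> = 4 * a * b * c\<^sup>2 + 2 * n * (a + 1) * (b + 1) * c + 4 * n\<^sup>2"
    unfolding w z by (simp add: power2_eq_square algebra_simps)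
  finally have ssq: "s\<^sup>2 = 4 * a * b * c\<^sup>2 + 2 * n * (a + 1) * (b + 1) * c + 4 * n\<^sup>2 - t\<^sup>2" by simp
  have "c\<^sup>2 * M\<^sup>2 = s\<^sup>2 * t\<^sup>2" using st by (metis power_mult_distrib mult.commute)
  hence runge: "c\<^sup>2 * (M\<^sup>2 - 4 * a * b * t\<^sup>2) = t\<^sup>2 * (2 * n * (a + 1) * (b + 1) * c + 4 * n\<^sup>2 - t\<^sup>2)"
    unfolding ssq by (simp add: algebra_simps)
  have M: "0 \<le> M" "M \<le> L"
    using assms(1,2,4) by (auto simp: M_def L_def intro!: mult_mono mult_nonneg_nonneg)
  have L1: "1 \<le> L" using ab assms(4) unfolding L_def
    by (simp add: int_one_le_iff_zero_less mult.assoc)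
  have nL: "n \<le> L" using ab assms(4) mult_left_mono[of 1 "a * b" n] by (simp add: L_def mult.assoc)
  have "1 * c \<le> a * c" "1 * c \<le> b * c" using assms(1-3) by (intro mult_right_mono; simp)+
  hence "c \<le> a * c + n" "c \<le> b * c + n" using assms(4) by linarith+
  hence "c * c \<le> (a * c + n) * (b * c + n)" using assms(3) by (intro mult_mono) auto
  hence "c\<^sup>2 \<le> w\<^sup>2" unfolding w by (simp add: power2_eq_square)
  hence "c \<le> w" by (rule power2_le_imp_le) (use wz(1) in simp)
  hence "2 * c \<le> s" using wz by (simp add: s_def)
  hence "2 * c * t \<le> M * c" using t st mult_right_mono[of "2 * c" s t] by simp
  hence "c * (2 * t) \<le> c * M" by (simp add: mult_ac)
  hence tL: "2 * t \<le> L" using assms(3) M(2) by (simp only: mult_le_cancel_left_pos)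
  have "(2 * t)\<^sup>2 \<le> L\<^sup>2" using tL t by (intro power_mono) auto
  hence t2: "4 * t\<^sup>2 \<le> L\<^sup>2" by (simp add: power_mult_distrib)
  have Lpow: "L \<le> L ^ 3" "L\<^sup>2 \<le> L ^ 3"
    using L1 self_le_power[of L 3] power_increasing[of 2 3 L] by auto
  show ?thesis
  proof (cases "t\<^sup>2 < c \<and> n \<le> c")
    case False
    thus ?thesis using t2 nL Lpow L1 unfolding L_def[symmetric] by linarith
  next
    case True
    have "c \<le> 2 * n * (a + 1) * (b + 1) * c"
      using mult_right_mono[of 1 "2 * n * (a + 1) * (b + 1)" c] assms(1-4)
      by (simp add: int_one_le_iff_zero_less)
    moreover have "4 * n\<^sup>2 \<ge> 0" by simp
    ultimately have "2 * n * (a + 1) * (b + 1) * c + 4 * n\<^sup>2 - t\<^sup>2 > 0" using True by linarith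
    hence "c\<^sup>2 * (M\<^sup>2 - 4 * a * b * t\<^sup>2) > 0" unfolding runge using t by simp
    hence "M\<^sup>2 - 4 * a * b * t\<^sup>2 \<ge> 1" using assms(3) by (simp add: zero_less_mult_iff)
    hence "c\<^sup>2 * 1 \<le> c\<^sup>2 * (M\<^sup>2 - 4 * a * b * t\<^sup>2)" by (intro mult_left_mono) auto
    also have "\<dots> \<le> t\<^sup>2 * (2 * n * (a + 1) * (b + 1) * c + 4 * n\<^sup>2)"
      unfolding runge by (intro mult_left_mono) auto
    also have "\<dots> \<le> t\<^sup>2 * (12 * (L * c))"
    proof (intro mult_left_mono)
      have "2 * n * (a + 1) * (b + 1) * c \<le> 2 * n * (2 * a) * (2 * b) * c"
        using assms(1-4) by (intro mult_mono) auto
      moreover have "n * n \<le> L * c" using True nL assms(4) by (intro mult_mono) auto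
      ultimately show "2 * n * (a + 1) * (b + 1) * c + 4 * n\<^sup>2 \<le> 12 * (L * c)"
        by (simp add: L_def power2_eq_square mult_ac)
    qed simp
    also have "\<dots> = 4 * t\<^sup>2 * (3 * (L * c))" by simp
    also have "\<dots> \<le> L\<^sup>2 * (3 * (L * c))" using t2 L1 assms(3) by (intro mult_right_mono) auto
    finally have "c * c \<le> c * (3 * L ^ 3)" by (simp add: power2_eq_square power3_eq_cube mult_ac)
    hence "c \<le> 3 * L ^ 3" using assms(3) by (simp only: mult_le_cancel_left_pos)
    thus ?thesis by (simp add: L_def)
  qed
qed

section \<open>Sets whose shifted subset products are powers\<close>

lemma two_smallest_and_cofactor:
  fixes S :: "int set"
  assumes "finite S" and "card S \<ge> m + 2" and "\<And>x. x \<in> S \<Longrightarrow> x > 1"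
  obtains a b C where "a \<in> S" and "b \<in> S" and "a < b" and "C \<subseteq> S - {a, b}" and "b ^ m \<le> \<Prod>C"
proof -
  define a b C where "a = Min S" and "b = Min (S - {a})" and "C = S - {a, b}"
  have S: "S \<noteq> {}" using assms(2) by auto
  have a: "a \<in> S" unfolding a_def using assms(1) S by simp
  have card_a: "card (S - {a}) \<ge> m + 1" using assms(1,2) a by simp
  hence ne: "S - {a} \<noteq> {}" by (metis Suc_eq_plus1 card.empty not_less_eq_eq zero_le)
  have b: "b \<in> S - {a}" unfolding b_def using assms(1) ne by (intro Min_in) auto
  have "a \<le> b" using b assms(1) by (simp add: a_def)
  hence ab: "a < b" using b by auto
  have C: "C = S - {a} - {b}" by (auto simp: C_def)
  have cardC: "card C \<ge> m" unfolding C using card_a b assms(1) by simp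
  have b1: "b > 1" using assms(3) b by auto
  have "b ^ m \<le> b ^ card C" using cardC b1 by (intro power_increasing) auto
  also have "\<dots> = (\<Prod>x\<in>C. b)" by simp
  also have "\<dots> \<le> \<Prod>C" using b1 assms(1) by (intro prod_mono) (auto simp: C b_def)
  finally show ?thesis using that[of a b C] a b ab by (auto simp: C_def)
qed

lemma no_large_power_shifted_set:
  fixes n :: int and S :: "int set"
  assumes "n \<ge> 1" and "finite S" and "\<And>x. x \<in> S \<Longrightarrow> x > 1"
    and power: "\<And>B. B \<subseteq> S \<Longrightarrow> is_nth_power k (\<Prod>B + n)"
    and k: "k = 2 \<and> card S \<ge> 16 \<or> k \<ge> 3 \<and> card S \<ge> 9"
  shows False
proof -
  define m :: nat where "m = (if k = 2 then 14 else 7)"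
  have "card S \<ge> m + 2" using k by (auto simp: m_def)
  then obtain a b C where a: "a \<in> S" and b: "b \<in> S" and ab: "a < b" and C: "C \<subseteq> S - {a, b}"
    and bC: "b ^ m \<le> \<Prod>C"
    using two_smallest_and_cofactor[OF assms(2) _ assms(3)] by blast
  define c where "c = \<Prod>C"
  have a1: "a > 1" and b1: "b > 1" using a b assms(3) by auto
  have c: "c > 0" using bC b1 by (auto simp: c_def intro: less_le_trans[of _ "b ^ m"])
  have fin: "finite C" using C assms(2) finite_subset by blast
  have notin: "a \<notin> C" "b \<notin> C" using C by auto
  have "\<Prod>(insert a C) = a * c" "\<Prod>(insert b C) = b * c" "\<Prod>(insert a (insert b C)) = a * b * c"
    using fin notin ab by (auto simp: c_def)
  hence powers: "is_nth_power k (c + n)" "is_nth_power k (a * c + n)" "is_nth_power k (b * c + n)"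
    "is_nth_power k (a * b * c + n)" "is_nth_power k (1 + n)" "is_nth_power k (a + n)"
    using power[of C] power[of "insert a C"] power[of "insert b C"]
      power[of "insert a (insert b C)"] power[of "{}"] power[of "{a}"] C a b
    by (auto simp: c_def)
  have k1: "Suc (k - 1) = k" using k by auto
  have na: "n ^ (k - 1) < a ^ k"
    using shift_less_power[of "k - 1" n a] powers(5,6) a1 assms(1) by (simp only: k1)
  show False
  proof (cases "k = 2")
    case True
    have "n \<le> a\<^sup>2" using na True by simp
    also have "\<dots> \<le> b\<^sup>2" using ab a1 by (intro power_mono) auto
    finally have "n * a * b \<le> b\<^sup>2 * b * b" using ab a1 assms(1) by (intro mult_mono) auto
    hence nab: "n * a * b \<le> b ^ 4" by (simp add: power4_eq_xxxx power2_eq_square mult_ac)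
    have "c \<le> 3 * (n * a * b) ^ 3"
      using cofactor_bound_squares[OF a1 b1 c assms(1)] powers True by simp
    also have "\<dots> \<le> 3 * (b ^ 4) ^ 3"
      using nab a1 b1 assms(1) by (intro mult_left_mono power_mono) auto
    also have "\<dots> = 3 * b ^ 12" by simp
    also have "\<dots> < b\<^sup>2 * b ^ 12"
    proof (intro mult_strict_right_mono)
      have "(2::int)\<^sup>2 \<le> b\<^sup>2" using b1 by (intro power_mono) auto
      thus "3 < b\<^sup>2" by simp
    qed (use b1 in simp)
    also have "\<dots> = b ^ m" by (simp add: m_def True flip: power_add)
    finally show False using bC by (simp add: c_def)
  next
    case False
    then obtain j where j: "k = j + 3" using k by (metis add.commute le_Suc_ex)
    (* The exponent (k-1)/k is at least 2/3, so the bound on n is weakened to n^2 < a^3, which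
       no longer involves k. *)
    have "n ^ (2 * k) \<le> n ^ ((k - 1) * 3)"
      using assms(1) j by (intro power_increasing) auto
    hence "(n\<^sup>2) ^ k \<le> (n ^ (k - 1)) ^ 3" by (simp only: power_mult)
    also have "\<dots> < (a ^ k) ^ 3" using na assms(1) by (intro power_strict_mono) auto
    also have "\<dots> = (a ^ 3) ^ k" by (simp only: mult.commute flip: power_mult)
    finally have "n\<^sup>2 < a ^ 3" by (rule power_less_imp_less_base) (use a1 in simp)
    also have "a ^ 3 < b ^ 3" using ab a1 by (intro power_strict_mono) auto
    finally have "n\<^sup>2 \<le> b ^ 3" by simp
    hence nb: "(n\<^sup>2) ^ k \<le> (b ^ 3) ^ k" by (rule power_mono) simp
    have "c ^ (j + 1) < n ^ k * (a * b)"
      using cofactor_bound[OF a1 b1 c assms(1), of "j + 1"] powers j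
      by (simp add: numeral_3_eq_3)
    hence "(c ^ (j + 1))\<^sup>2 < (n ^ k * (a * b))\<^sup>2" using c by (intro power_strict_mono) auto
    also have "\<dots> = (n\<^sup>2) ^ k * (a * b)\<^sup>2"
      by (simp add: power_mult_distrib mult.commute flip: power_mult)
    also have "\<dots> \<le> (b ^ 3) ^ k * (b * b)\<^sup>2"
      using ab a1 b1 by (intro mult_mono[OF nb] power_mono) auto
    also have "\<dots> = b ^ (3 * k + 4)"
      by (simp add: power_add power_mult flip: power2_eq_square)
    (* 14(k-2) - (3k+4) = 11k - 32 is positive from k = 3 on: seven factors in c are just enough. *)
    also have "\<dots> \<le> b ^ (14 * (j + 1))" using b1 j by (intro power_increasing) auto
    also have "\<dots> = ((b ^ 7) ^ (j + 1))\<^sup>2" by (simp only: flip: power_mult) (simp add: mult_ac)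
    also have "\<dots> \<le> (c ^ (j + 1))\<^sup>2"
      using bC False b1 by (intro power_mono) (auto simp: m_def c_def)
    finally show False by simp
  qed
qed

theorem theorem1p8:
  fixes k :: nat and n :: int and A :: "int set"
  assumes "k \<ge> 2" and "n \<ge> 1"
    and "\<And>a. a \<in> A \<Longrightarrow> a > 0"
    and "\<And>B. B \<subseteq> A \<Longrightarrow> finite B \<Longrightarrow> is_nth_power k ((\<Prod>a\<in>B. a) + n)"
  shows "(k = 2 \<longrightarrow> finite A \<and> card A \<le> 132) \<and> (k \<ge> 3 \<longrightarrow> finite A \<and> card A \<le> 9)"
proof -
  have bound: "finite A \<and> card A \<le> N" if N: "k = 2 \<and> N \<ge> 16 \<or> k \<ge> 3 \<and> N \<ge> 9" for N
  proof (rule ccontr)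
    assume "\<not> (finite A \<and> card A \<le> N)"
    then obtain T where T: "T \<subseteq> A" "finite T" "card T = Suc N"
      by (metis infinite_arbitrarily_large not_less_eq_eq obtain_subset_with_card_n)
    show False
    proof (rule no_large_power_shifted_set[OF assms(2)])
      show "finite (T - {1})" using T by simp
      show "x > 1" if "x \<in> T - {1}" for x using assms(3)[of x] that T by force
      show "is_nth_power k (\<Prod>B + n)" if "B \<subseteq> T - {1}" for B
        using assms(4)[of B] that T finite_subset[of B T] by auto
      have "N \<le> card (T - {1})" using T by (simp add: card_Diff_singleton_if)
      thus "k = 2 \<and> card (T - {1}) \<ge> 16 \<or> k \<ge> 3 \<and> card (T - {1}) \<ge> 9" using N by auto
    qed
  qed
  show ?thesis using bound[of 132] bound[of 9] by auto
qed

end
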